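(* The hinge loss $\ell_{hinge}(t)=\max\{0,1-t\}$ is inconsistent with $\mathsf{AUTKC}$ when there exists $\boldsymbol{x}$ such that $\sum_{k=K+2}^{C}\eta(\boldsymbol{x})_{[k]}>\frac{K}{K+1}$.
   Context: $\mathcal{X}$ is the input space, $\mathcal{Y}=\{1,\dots,C\}$ is the label space, $\mathcal{D}$ is a probability distribution on $\mathcal{X}\times\mathcal{Y}$, and $\eta(\boldsymbol{x})_y=\mathbb{P}[y\mid\boldsymbol{x}]$ for $\boldsymbol{x}\in\mathcal{X}$. The positive integer $K$ is a hyperparameter. It is assumed that there are no ties in $\eta(\boldsymbol{x})\in\mathbb{R}^C$, i.e. $\eta(\boldsymbol{x})_{[1]}>\cdots>\eta(\boldsymbol{x})_{[C]}$, where the subscript $[k]$ denotes the $k$-th greatest entry of a vector. Score functions are measurable maps $f:\mathcal{X}\to\mathbb{R}^C$; write $\boldsymbol{s}=f(\boldsymbol{x})$ and $s_y=f(\boldsymbol{x})_y$. $\pi_{f(\boldsymbol{x})}(y)\in\{1,\dots,C\}$ is the position of $f(\boldsymbol{x})_y$ when $f(\boldsymbol{x})$ is sorted in descending order. Ties in $f(\boldsymbol{x})$ may exist and are assumed to be wrongly broken: if $\eta(\boldsymbol{x})_{y_1}>\eta(\boldsymbol{x})_{y_2}$ and $f(\boldsymbol{x})_{y_1}=f(\boldsymbol{x})_{y_2}$, then $\pi_{f(\boldsymbol{x})}(y_1)>\pi_{f(\boldsymbol{x})}(y_2)$. The $\mathsf{AUTKC}$ risk is $\mathcal{R}_K(f)=\mathbb{E}_{(\boldsymbol{x},y)\sim\mathcal{D}}\big[\frac1K\sum_{k=1}^K\mathbf{1}[\pi_{f(\boldsymbol{x})}(y)>k]\big]$.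 For a surrogate loss $\ell:\mathbb{R}\to\mathbb{R}_+$, the surrogate risk is $\mathcal{R}_K^{\ell}(f)=\mathbb{E}_{(\boldsymbol{x},y)\sim\mathcal{D}}\big[\frac1K\sum_{k=1}^{K+1}\ell(s_y-s_{[k]})\big]$. The loss $\ell$ is consistent with $\mathsf{AUTKC}$ if for every sequence $\{f_t\}_{t=1,2,\dots}$ of score functions, $\mathcal{R}_K^{\ell}(f_t)\to\inf_f\mathcal{R}_K^{\ell}(f)$ implies $\mathcal{R}_K(f_t)\to\inf_f\mathcal{R}_K(f)$ (infima over all score functions); otherwise it is inconsistent with $\mathsf{AUTKC}$.
   Formalization: "There exists x" with the tail-sum inequality is replaced by: the set of such x has positive probability under the marginal of D on the input space; for a single x of probability zero the claim fails, since both risks ignore null sets. *)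

theory Defs
  imports "HOL-Probability.Probability"
begin

text \<open>
  Labels are the elements of a finite type \<open>'c\<close>, so the number of classes is \<open>CARD('c)\<close>;
  nothing below depends on an order of the labels. Inputs are the points of \<open>space X\<close>,
  where \<open>X\<close> is used only as a measurable space.
\<close>

text \<open>Only meaningful for \<open>1 \<le> k \<le> CARD('c)\<close>.\<close>

definition kth_greatest :: "real ^ 'c::finite \<Rightarrow> nat \<Rightarrow> real" where
  "kth_greatest v k = rev (sorted_list_of_multiset (image_mset (($) v) (mset_set UNIV))) ! (k - 1)"

definition no_ties :: "real ^ 'c::finite \<Rightarrow> bool" where
  "no_ties v \<longleftrightarrow> (\<forall>i j. 1 \<le> i \<and> i < j \<and> j \<le> CARD('c) \<longrightarrow> kth_greatest v i > kth_greatest v j)"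

text \<open>
  Conditional probabilities are only determined up to null sets; this says that \<open>\<eta>\<close> is one
  version of \<open>y \<mapsto> P[y | x]\<close>, all of whose values are probability vectors.
\<close>

definition label_posterior ::
    "'x measure \<Rightarrow> ('x \<times> 'c::finite) measure \<Rightarrow> ('x \<Rightarrow> real ^ 'c) \<Rightarrow> bool" where
  "label_posterior X D \<eta> \<longleftrightarrow>
     \<eta> \<in> borel_measurable X \<and>
     (\<forall>x\<in>space X. (\<forall>y. 0 \<le> \<eta> x $ y) \<and> (\<Sum>y\<in>UNIV. \<eta> x $ y) = 1) \<and>
     (\<forall>A\<in>sets X. \<forall>y. emeasure D (A \<times> {y}) =
        (\<integral>\<^sup>+x\<in>A. ennreal (\<eta> x $ y) \<partial>distr D X fst))"

text \<open>
  \<open>sorted_position p s \<pi>\<close>: \<open>\<pi>\<close> ranks the labels by descending score \<open>s\<close>, ties being broken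
  wrongly with respect to \<open>p\<close>.
\<close>

definition sorted_position ::
    "real ^ 'c::finite \<Rightarrow> real ^ 'c \<Rightarrow> ('c \<Rightarrow> nat) \<Rightarrow> bool" where
  "sorted_position p s \<pi> \<longleftrightarrow>
     bij_betw \<pi> UNIV {1..CARD('c)} \<and>
     (\<forall>y1 y2. s $ y1 > s $ y2 \<longrightarrow> \<pi> y1 < \<pi> y2) \<and>
     (\<forall>y1 y2. p $ y1 > p $ y2 \<and> s $ y1 = s $ y2 \<longrightarrow> \<pi> y1 > \<pi> y2)"

text \<open>Well defined if \<open>p\<close> has no ties, see \<open>position_unique\<close> below.\<close>

definition position :: "real ^ 'c::finite \<Rightarrow> real ^ 'c \<Rightarrow> 'c \<Rightarrow> nat" where
  "position p s = (THE \<pi>. sorted_position p s \<pi>)"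

abbreviation score_functions :: "'x measure \<Rightarrow> ('x \<Rightarrow> real ^ 'c::finite) set" where
  "score_functions X \<equiv> borel_measurable X"

text \<open>
  Risks are expectations of nonnegative quantities and may be infinite (for the surrogate risk
  of a non-integrable score function), so they take values in \<open>ennreal\<close>.
\<close>

definition autkc_risk ::
    "('x \<times> 'c::finite) measure \<Rightarrow> ('x \<Rightarrow> real ^ 'c) \<Rightarrow> nat \<Rightarrow> ('x \<Rightarrow> real ^ 'c) \<Rightarrow> ennreal" where
  "autkc_risk D \<eta> K f =
     (\<integral>\<^sup>+(x, y). ennreal (1 / real K * (\<Sum>k=1..K. of_bool (position (\<eta> x) (f x) y > k))) \<partial>D)"

text \<open>Intended for \<open>K + 1 \<le> CARD('c)\<close> and nonnegative \<open>\<l>\<close>.\<close>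

definition surrogate_risk ::
    "('x \<times> 'c::finite) measure \<Rightarrow> nat \<Rightarrow> (real \<Rightarrow> real) \<Rightarrow> ('x \<Rightarrow> real ^ 'c) \<Rightarrow> ennreal" where
  "surrogate_risk D K \<l> f =
     (\<integral>\<^sup>+(x, y). ennreal (1 / real K * (\<Sum>k=1..K+1. \<l> (f x $ y - kth_greatest (f x) k))) \<partial>D)"

definition autkc_consistent ::
    "'x measure \<Rightarrow> ('x \<times> 'c::finite) measure \<Rightarrow> ('x \<Rightarrow> real ^ 'c) \<Rightarrow> nat \<Rightarrow> (real \<Rightarrow> real) \<Rightarrow> bool"
  where
  "autkc_consistent X D \<eta> K \<l> \<longleftrightarrow>
     (\<forall>f :: nat \<Rightarrow> 'x \<Rightarrow> real ^ 'c.
        (\<forall>t. f t \<in> score_functions X) \<longrightarrow>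
        (\<lambda>t. surrogate_risk D K \<l> (f t)) \<longlonglongrightarrow> (INF g\<in>score_functions X. surrogate_risk D K \<l> g) \<longrightarrow>
        (\<lambda>t. autkc_risk D \<eta> K (f t)) \<longlonglongrightarrow> (INF g\<in>score_functions X. autkc_risk D \<eta> K g))"

definition hinge_loss :: "real \<Rightarrow> real" where
  "hinge_loss t = max 0 (1 - t)"

text \<open>Sanity checks: positions exist and are unique when \<open>p\<close> has no ties.\<close>

lemma no_ties_imp_inj:
  fixes p :: "real ^ 'c::finite"
  assumes "no_ties p"
  shows "inj (($) p)"
proof -
  define xs where "xs = rev (sorted_list_of_multiset (image_mset (($) p) (mset_set UNIV)))"
  have ms: "mset xs = image_mset (($) p) (mset_set UNIV)"
    by (simp add: xs_def)
  have len: "length xs = CARD('c)"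
    by (metis ms size_mset size_image_mset size_mset_set)
  have lt: "xs ! i > xs ! j" if "i < j" "j < length xs" for i j
  proof -
    have "kth_greatest p (Suc i) > kth_greatest p (Suc j)"
      using assms that len unfolding no_ties_def by simp
    then show ?thesis by (simp add: kth_greatest_def xs_def)
  qed
  have "distinct xs"
    unfolding distinct_conv_nth by (metis lt less_irrefl linorder_neqE_nat)
  then have "card (set xs) = CARD('c)"
    using len by (simp add: distinct_card)
  moreover have "set xs = range (($) p)"
    by (metis finite_class.finite_UNIV finite_set_mset_mset_set ms set_image_mset set_mset_mset)
  ultimately show ?thesis
    by (simp add: eq_card_imp_inj_on)
qed

lemma position_unique:
  fixes p s :: "real ^ 'c::finite"
  assumes nt: "no_ties p"
  shows "\<exists>!\<pi>. sorted_position p s \<pi>"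
    and "position p s y = Suc (card {z. s $ z > s $ y \<or> s $ z = s $ y \<and> p $ z < p $ y})"
proof -
  define prec where "prec z y \<longleftrightarrow> s $ z > s $ y \<or> s $ z = s $ y \<and> p $ z < p $ y" for z y
  define r where "r y = Suc (card {z. prec z y})" for y
  have inj: "p $ a = p $ b \<Longrightarrow> a = b" for a b
    using no_ties_imp_inj[OF nt] by (auto dest: injD)
  have tot: "prec a b \<or> prec b a" if "a \<noteq> b" for a b
    using inj[of a b] that unfolding prec_def by (meson linorder_neqE_linordered_idom)
  have mono: "r a < r b" if "prec a b" for a b
  proof -
    have "{z. prec z a} \<subset> {z. prec z b}"
      using that unfolding prec_def by fastforce
    then show ?thesis by (simp add: r_def psubset_card_mono)
  qed
  have "inj r"
    by (rule injI) (metis less_irrefl mono tot)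
  have "range r \<subseteq> {1..CARD('c)}"
  proof safe
    fix y
    have "{z. prec z y} \<subset> UNIV" by (auto simp: prec_def)
    then have "card {z. prec z y} < CARD('c)" by (intro psubset_card_mono) auto
    then show "r y \<in> {1..CARD('c)}" by (auto simp: r_def)
  qed
  then have "range r = {1..CARD('c)}"
    by (intro card_subset_eq) (auto simp: card_image[OF \<open>inj r\<close>])
  with \<open>inj r\<close> have ex: "sorted_position p s r"
    unfolding sorted_position_def bij_betw_def by (auto intro!: mono simp: prec_def)
  have un: "\<pi> = r" if "sorted_position p s \<pi>" for \<pi>
  proof
    fix y
    have bij: "bij_betw \<pi> UNIV {1..CARD('c)}"
      and m: "\<And>a b. prec a b \<Longrightarrow> \<pi> a < \<pi> b"
      using that unfolding sorted_position_def prec_def by auto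
    have iff: "prec a b \<longleftrightarrow> \<pi> a < \<pi> b" for a b
      by (metis m tot less_asym less_irrefl)
    have "\<pi> ` {z. prec z y} = {1..<\<pi> y}"
    proof -
      have "\<pi> y \<in> {1..CARD('c)}" using bij by (auto simp: bij_betw_def)
      moreover have "range \<pi> = {1..CARD('c)}" using bij by (simp add: bij_betw_def)
      ultimately show ?thesis unfolding iff by (fastforce simp: image_def set_eq_iff)
    qed
    then have "card {z. prec z y} = \<pi> y - 1"
      by (metis bij bij_betw_def card_atLeastLessThan card_image inj_on_subset subset_UNIV)
    moreover have "\<pi> y \<ge> 1" using bij by (auto simp: bij_betw_def)
    ultimately show "\<pi> y = r y" by (simp add: r_def)
  qed
  show "\<exists>!\<pi>. sorted_position p s \<pi>" using ex un by blast
  have "position p s = r"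
    unfolding position_def using ex un by (rule the_equality)
  then show "position p s y = Suc (card {z. s $ z > s $ y \<or> s $ z = s $ y \<and> p $ z < p $ y})"
    by (simp add: r_def prec_def)
qed

end

theory Submission
  imports Defs
begin

text \<open>
  Let \<open>G\<close> be the set of inputs whose posterior mass outside the top \<open>K + 1\<close> labels exceeds
  \<open>K / (K + 1)\<close>. There every label has probability at most \<open>1 / (K + 1)\<close>. Since
  \<open>hinge_loss t \<ge> 1 - t\<close>, the conditional surrogate risk of \<open>s\<close> is at least
  \<open>(K + 1 + T - (K + 1) * (\<Sum>y. \<eta> y * s y)) / K\<close>, where \<open>T\<close> is the sum of the top
  \<open>K + 1\<close> scores. The weights \<open>(K + 1) * \<eta> y\<close> lie in \<open>[0, 1]\<close> and sum to \<open>K + 1\<close>, so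
  the weighted sum of the scores is at most \<open>T\<close>; hence \<open>(K + 1) / K\<close>, the value at
  \<open>s = 0\<close>, is minimal. Overwriting a minimizing sequence by the score \<open>0\<close> on \<open>G\<close> therefore
  keeps it minimizing. But the score \<open>0\<close>, with ties broken wrongly, ranks the labels on \<open>G\<close> in
  the reverse of the order of \<open>\<eta>\<close>, which by Chebyshev's sum inequality costs a fixed positive
  amount of \<open>AUTKC\<close> risk compared with using \<open>\<eta>\<close> itself as the score on \<open>G\<close>.
\<close>

section \<open>Order statistics and sums over ranks\<close>

text \<open>Sorting the labels by the key \<open>v\<close>, rather than sorting the bare values,
  keeps track of which label holds which rank. The resulting \<open>\<sigma>\<close> translates
  between ranks and labels, also when \<open>v\<close> has ties.\<close>

lemma kth_greatest_enumeration:
  fixes v :: "real ^ 'c::finite"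
  obtains \<sigma> where "bij_betw \<sigma> {1..CARD('c)} UNIV"
    and "\<And>k. k \<in> {1..CARD('c)} \<Longrightarrow> v $ \<sigma> k = kth_greatest v k"
proof -
  obtain zs :: "'c list" where zs: "set zs = UNIV" "distinct zs"
    using finite_distinct_list[of "UNIV :: 'c set"] by auto
  define ys where "ys = sort_key (($) v) zs"
  have ys: "set ys = UNIV" "distinct ys" "sorted (map (($) v) ys)"
    by (simp_all add: ys_def zs)
  have len: "length ys = CARD('c)"
    using ys distinct_card by metis
  have "mset ys = mset_set UNIV"
    using ys mset_set_set by metis
  then have "sorted_list_of_multiset (image_mset (($) v) (mset_set UNIV)) = map (($) v) ys"
    using ys(3) by (metis mset_map sorted_list_of_multiset_mset sorted_sort_id)
  then have kth: "kth_greatest v k = v $ (rev ys ! (k - 1))" if "k \<in> {1..CARD('c)}" for k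
    using that len nth_map[of "k - 1" "rev ys" "($) v"] by (simp add: kth_greatest_def rev_map less_eq_Suc_le)
  have "bij_betw (\<lambda>i. rev ys ! i) {..<CARD('c)} UNIV"
    by (rule bij_betw_nth) (use ys len in auto)
  moreover have "bij_betw (\<lambda>k. k - 1) {1..CARD('c)} {..<CARD('c)}"
    by (rule bij_betw_byWitness[where f' = Suc]) auto
  ultimately have "bij_betw (\<lambda>k. rev ys ! (k - 1)) {1..CARD('c)} UNIV"
    using bij_betw_trans by (fastforce simp: o_def)
  with kth that show thesis by metis
qed

lemma kth_greatest_antimono:
  fixes v :: "real ^ 'c::finite"
  assumes "1 \<le> i" "i \<le> j" "j \<le> CARD('c)"
  shows "kth_greatest v j \<le> kth_greatest v i"
proof -
  let ?xs = "sorted_list_of_multiset (image_mset (($) v) (mset_set UNIV))"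
  have "length ?xs = CARD('c)"
    by (metis mset_sorted_list_of_multiset size_mset size_image_mset size_mset_set)
  then show ?thesis
    using assms sorted_rev_nth_mono[of "rev ?xs" "i - 1" "j - 1"]
    by (simp add: kth_greatest_def)
qed

lemma sum_kth_greatest:
  fixes v :: "real ^ 'c::finite"
  shows "(\<Sum>k=1..CARD('c). h (kth_greatest v k)) = (\<Sum>y\<in>UNIV. h (v $ y))"
proof -
  obtain \<sigma> where \<sigma>: "bij_betw \<sigma> {1..CARD('c)} UNIV"
    "\<And>k. k \<in> {1..CARD('c)} \<Longrightarrow> v $ \<sigma> k = kth_greatest v k"
    by (rule kth_greatest_enumeration[of v]) auto
  have "(\<Sum>y\<in>UNIV. h (v $ y)) = (\<Sum>k=1..CARD('c). h (v $ \<sigma> k))"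
    by (rule sum.reindex_bij_betw[OF \<sigma>(1), symmetric])
  then show ?thesis using \<sigma>(2) by simp
qed

text \<open>The ranks whose value exceeds \<open>a\<close> form an initial segment of the ranks,
  with as many elements as there are entries above \<open>a\<close>. This turns superlevel sets of
  an order statistic into counting conditions, which is what measurability requires.\<close>

lemma less_kth_greatest_iff:
  fixes v :: "real ^ 'c::finite"
  assumes k: "1 \<le> k" "k \<le> CARD('c)"
  shows "a < kth_greatest v k \<longleftrightarrow> k \<le> card {z. a < v $ z}"
proof -
  obtain \<sigma> where \<sigma>: "bij_betw \<sigma> {1..CARD('c)} UNIV"
    "\<And>k. k \<in> {1..CARD('c)} \<Longrightarrow> v $ \<sigma> k = kth_greatest v k"
    by (rule kth_greatest_enumeration[of v]) auto
  define I where "I = {i \<in> {1..CARD('c)}. a < kth_greatest v i}"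
  have "{z. a < v $ z} = \<sigma> ` I"
    using \<sigma> unfolding I_def bij_betw_def by (auto simp: image_iff set_eq_iff) (metis atLeastAtMost_iff)
  moreover have "inj_on \<sigma> I"
    using \<sigma>(1) by (auto simp: I_def bij_betw_def intro: inj_on_subset)
  ultimately have card: "card {z. a < v $ z} = card I"
    by (simp add: card_image)
  have fin: "finite I" by (simp add: I_def)
  show ?thesis
  proof
    assume "a < kth_greatest v k"
    then have "{1..k} \<subseteq> I"
      using k kth_greatest_antimono[of _ k v] by (fastforce simp: I_def)
    then show "k \<le> card {z. a < v $ z}"
      using card_mono[OF fin, of "{1..k}"] card by simp
  next
    assume le: "k \<le> card {z. a < v $ z}"
    show "a < kth_greatest v k"
    proof (rule ccontr)
      assume "\<not> a < kth_greatest v k"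
      then have "\<not> a < kth_greatest v i" if "k \<le> i" "i \<le> CARD('c)" for i
        using that k kth_greatest_antimono[of k i v] by linarith
      then have "I \<subseteq> {1..<k}"
        by (auto simp: I_def) (meson not_less)
      then have "card I \<le> k - 1"
        using card_mono[of "{1..<k}" I] by simp
      then show False using le k card by linarith
    qed
  qed
qed

section \<open>Measurability of order statistics and positions\<close>

lemma borel_measurable_vec_nth [measurable (raw)]:
  fixes f :: "'x \<Rightarrow> real ^ 'c::finite"
  assumes "f \<in> borel_measurable M"
  shows "(\<lambda>x. f x $ y) \<in> borel_measurable M"
  using borel_measurable_continuous_onI[of "\<lambda>v :: real ^ 'c. v $ y"] assms
  by (auto intro: measurable_compose continuous_intros)

lemma card_Collect_measurable:
  fixes P :: "'x \<Rightarrow> 'c::finite \<Rightarrow> bool"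
  assumes "\<And>z. Measurable.pred M (\<lambda>x. P x z)"
  shows "(\<lambda>x. card {z. P x z}) \<in> measurable M (count_space UNIV)"
proof -
  have "card {z. P x z} = (\<Sum>z\<in>UNIV. if P x z then 1 else 0)" for x
    by (simp add: sum.If_cases)
  then show ?thesis using assms by simp
qed

lemma kth_greatest_measurable:
  fixes f :: "'x \<Rightarrow> real ^ 'c::finite"
  assumes f[measurable]: "f \<in> borel_measurable M" and k: "1 \<le> k" "k \<le> CARD('c)"
  shows "(\<lambda>x. kth_greatest (f x) k) \<in> borel_measurable M"
proof (rule borel_measurableI_greater)
  fix a
  have [measurable]: "(\<lambda>x. card {z. a < f x $ z}) \<in> measurable M (count_space UNIV)"
    by (rule card_Collect_measurable) measurable
  show "{x \<in> space M. a < kth_greatest (f x) k} \<in> sets M"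
    unfolding less_kth_greatest_iff[OF k] by measurable
qed

text \<open>The absence of ties in \<open>\<eta> x\<close> allows the definite description in
  \<open>position\<close> to be replaced by its counting formula, a cardinality of a set cut out by
  measurable predicates.\<close>

lemma position_measurable:
  fixes \<eta> f :: "'x \<Rightarrow> real ^ 'c::finite"
  assumes [measurable]: "\<eta> \<in> borel_measurable M" "f \<in> borel_measurable M"
    and nt: "\<And>x. x \<in> space M \<Longrightarrow> no_ties (\<eta> x)"
  shows "(\<lambda>x. position (\<eta> x) (f x) y) \<in> measurable M (count_space UNIV)"
proof -
  have "(\<lambda>x. card {z. f x $ z > f x $ y \<or> f x $ z = f x $ y \<and> \<eta> x $ z < \<eta> x $ y})
      \<in> measurable M (count_space UNIV)"
    by (rule card_Collect_measurable) measurable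
  then have "(\<lambda>x. Suc (card {z. f x $ z > f x $ y \<or> f x $ z = f x $ y \<and> \<eta> x $ z < \<eta> x $ y}))
      \<in> measurable M (count_space UNIV)"
    by measurable
  then show ?thesis
    by (rule measurable_cong[THEN iffD1, rotated]) (simp add: position_unique(2) nt)
qed

section \<open>Averaging a loss over the conditional label distribution\<close>

text \<open>The defining identity of the posterior is extended from sets to functions:
  \<open>D\<close> is cut into one slice per label, and each slice is pushed forward to the inputs.
  Both risks thereby become integrals of conditional risks over the input marginal.\<close>

lemma label_posterior_nn_integral:
  fixes D :: "('x \<times> 'c::finite) measure" and L :: "'x \<Rightarrow> 'c \<Rightarrow> real"
  assumes sD: "sets D = sets (X \<Otimes>\<^sub>M count_space UNIV)"
    and post: "label_posterior X D \<eta>"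
    and L: "\<And>y. (\<lambda>x. L x y) \<in> borel_measurable X" "\<And>x y. 0 \<le> L x y"
  shows "(\<integral>\<^sup>+(x, y). ennreal (L x y) \<partial>D)
       = (\<integral>\<^sup>+x. ennreal (\<Sum>y\<in>UNIV. \<eta> x $ y * L x y) \<partial>distr D X fst)"
proof -
  note L(1)[measurable]
  have \<eta>[measurable]: "\<eta> \<in> borel_measurable X"
    and \<eta>0: "\<And>x y. x \<in> space X \<Longrightarrow> 0 \<le> \<eta> x $ y"
    and em: "\<And>A y. A \<in> sets X \<Longrightarrow> emeasure D (A \<times> {y}) =
        (\<integral>\<^sup>+x\<in>A. ennreal (\<eta> x $ y) \<partial>distr D X fst)"
    using post by (auto simp: label_posterior_def)
  have fst[measurable]: "fst \<in> measurable D X"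
    by (simp add: measurable_cong_sets[OF sD refl])
  have spD: "space D = space X \<times> UNIV"
    using sets_eq_imp_space_eq[OF sD] by (simp add: space_pair_measure)
  define \<mu> where "\<mu> = distr D X fst"
  have [measurable_cong]: "sets \<mu> = sets X" and sp\<mu>: "space \<mu> = space X"
    by (simp_all add: \<mu>_def)
  define S where "S z = {w \<in> space D. snd w = z}" for z
  have S[measurable]: "S z \<in> sets D" for z
  proof -
    have "S z = space X \<times> {z}" by (auto simp: S_def spD)
    then show ?thesis by (simp add: sD)
  qed
  \<comment> \<open>The part of the slice of \<open>z\<close> lying over \<open>A\<close> is exactly
    \<open>A \<times> {z}\<close>, whose mass \<open>label_posterior\<close> prescribes.\<close>
  have slice_distr: "distr (density D (indicator (S z))) X fst = density \<mu> (\<lambda>x. ennreal (\<eta> x $ z))" for z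
  proof (rule measure_eqI)
    fix A assume "A \<in> sets (distr (density D (indicator (S z))) X fst)"
    then have A[measurable]: "A \<in> sets X" by simp
    have pre[measurable]: "fst -` A \<inter> space D \<in> sets D"
      using measurable_sets[OF fst A] .
    have eq: "S z \<inter> (fst -` A \<inter> space D) = A \<times> {z}"
      using sets.sets_into_space[OF A] by (auto simp: S_def spD)
    have "emeasure (distr (density D (indicator (S z))) X fst) A
        = (\<integral>\<^sup>+w. indicator (S z) w * indicator (fst -` A \<inter> space D) w \<partial>D)"
      by (simp add: emeasure_distr emeasure_density)
    also have "\<dots> = emeasure D (A \<times> {z})"
      unfolding eq[symmetric] by (simp flip: indicator_inter_arith)
    also have "\<dots> = emeasure (density \<mu> (\<lambda>x. ennreal (\<eta> x $ z))) A"
      using em[OF A] by (simp add: emeasure_density \<mu>_def)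
    finally show "emeasure (distr (density D (indicator (S z))) X fst) A
        = emeasure (density \<mu> (\<lambda>x. ennreal (\<eta> x $ z))) A" .
  qed (simp add: \<mu>_def)
  have "(\<integral>\<^sup>+(x, y). ennreal (L x y) \<partial>D)
      = (\<integral>\<^sup>+w. (\<Sum>z\<in>UNIV. indicator (S z) w * ennreal (L (fst w) z)) \<partial>D)"
  proof (rule nn_integral_cong)
    fix w assume "w \<in> space D"
    then have "indicator (S z) w = (if z = snd w then 1 else 0 :: ennreal)" for z
      by (auto simp: S_def)
    then show "(case w of (x, y) \<Rightarrow> ennreal (L x y))
        = (\<Sum>z\<in>UNIV. indicator (S z) w * ennreal (L (fst w) z))"
      by (simp add: case_prod_beta if_distrib[of "\<lambda>i. i * _"] cong: if_cong)
  qed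
  also have "\<dots> = (\<Sum>z\<in>UNIV. \<integral>\<^sup>+w. indicator (S z) w * ennreal (L (fst w) z) \<partial>D)"
    by (rule nn_integral_sum) measurable
  also have "\<dots> = (\<Sum>z\<in>UNIV. \<integral>\<^sup>+x. ennreal (\<eta> x $ z) * ennreal (L x z) \<partial>\<mu>)"
  proof (rule sum.cong[OF refl])
    fix z
    have "(\<integral>\<^sup>+w. indicator (S z) w * ennreal (L (fst w) z) \<partial>D)
        = (\<integral>\<^sup>+w. ennreal (L (fst w) z) \<partial>density D (indicator (S z)))"
      by (simp add: nn_integral_density)
    also have "\<dots> = (\<integral>\<^sup>+x. ennreal (L x z) \<partial>distr (density D (indicator (S z))) X fst)"
      by (simp add: nn_integral_distr)
    also have "\<dots> = (\<integral>\<^sup>+x. ennreal (\<eta> x $ z) * ennreal (L x z) \<partial>\<mu>)"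
      unfolding slice_distr by (simp add: nn_integral_density)
    finally show "(\<integral>\<^sup>+w. indicator (S z) w * ennreal (L (fst w) z) \<partial>D)
        = (\<integral>\<^sup>+x. ennreal (\<eta> x $ z) * ennreal (L x z) \<partial>\<mu>)" .
  qed
  also have "\<dots> = (\<integral>\<^sup>+x. (\<Sum>z\<in>UNIV. ennreal (\<eta> x $ z) * ennreal (L x z)) \<partial>\<mu>)"
    by (rule nn_integral_sum[symmetric]) measurable
  also have "\<dots> = (\<integral>\<^sup>+x. ennreal (\<Sum>y\<in>UNIV. \<eta> x $ y * L x y) \<partial>\<mu>)"
    by (rule nn_integral_cong) (simp add: sp\<mu> \<eta>0 L(2) flip: ennreal_mult sum_ennreal)
  finally show ?thesis by (simp add: \<mu>_def)
qed

section \<open>Minimality of the zero score for the conditional hinge risk\<close>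

text \<open>The largest entry is at most the mass of the top \<open>K + 1\<close> entries, which is
  one minus the tail and hence below \<open>1 / (K + 1)\<close>.\<close>

lemma entry_le_if_tail_gt:
  fixes p :: "real ^ 'c::finite"
  assumes p: "\<And>y. 0 \<le> p $ y" "(\<Sum>y\<in>UNIV. p $ y) = 1" and C: "K + 2 \<le> CARD('c)"
    and tail: "(\<Sum>k=K+2..CARD('c). kth_greatest p k) > real K / (real K + 1)"
  shows "(real K + 1) * p $ y \<le> 1"
proof -
  obtain \<sigma> where \<sigma>: "bij_betw \<sigma> {1..CARD('c)} UNIV"
    "\<And>k. k \<in> {1..CARD('c)} \<Longrightarrow> p $ \<sigma> k = kth_greatest p k"
    by (rule kth_greatest_enumeration[of p]) auto
  have nn: "0 \<le> kth_greatest p k" if "k \<in> {1..CARD('c)}" for k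
    using \<sigma>(2)[OF that] p(1) by metis
  obtain j where j: "j \<in> {1..CARD('c)}" "y = \<sigma> j"
    using \<sigma>(1) by (metis UNIV_I bij_betw_def imageE)
  have "p $ y \<le> kth_greatest p 1"
    using j \<sigma>(2) kth_greatest_antimono[of 1 j p] by simp
  also have "\<dots> \<le> (\<Sum>k=1..K+1. kth_greatest p k)"
    by (rule member_le_sum) (use nn C in auto)
  also have "\<dots> = 1 - (\<Sum>k=K+2..CARD('c). kth_greatest p k)"
  proof -
    have "{1..CARD('c)} = {1..K+1} \<union> {K+2..CARD('c)}" using C by auto
    then have "(\<Sum>k=1..CARD('c). kth_greatest p k)
        = (\<Sum>k=1..K+1. kth_greatest p k) + (\<Sum>k=K+2..CARD('c). kth_greatest p k)"
      by (simp add: sum.union_disjoint)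
    then show ?thesis using sum_kth_greatest[of "\<lambda>t. t" p] p(2) by simp
  qed
  also have "\<dots> \<le> 1 / (real K + 1)"
    using tail by (simp add: field_simps)
  finally show ?thesis by (simp add: field_simps)
qed

text \<open>Since the weights total \<open>m\<close>, subtracting the threshold \<open>c\<close>,
  the \<open>m\<close>-th greatest score, lowers both sides by \<open>m * c\<close>. Each weighted
  term is then at most its positive part, and the positive parts vanish beyond rank
  \<open>m\<close>.\<close>

lemma weighted_sum_le_sum_kth_greatest:
  fixes s :: "real ^ 'c::finite"
  assumes w: "\<And>y. 0 \<le> w y" "\<And>y. w y \<le> 1" "(\<Sum>y\<in>UNIV. w y) = real m"
    and m: "1 \<le> m" "m \<le> CARD('c)"
  shows "(\<Sum>y\<in>UNIV. w y * s $ y) \<le> (\<Sum>k=1..m. kth_greatest s k)"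
proof -
  define c where "c = kth_greatest s m"
  have "(\<Sum>y\<in>UNIV. w y * (s $ y - c)) \<le> (\<Sum>y\<in>UNIV. max 0 (s $ y - c))"
  proof (rule sum_mono)
    fix y show "w y * (s $ y - c) \<le> max 0 (s $ y - c)"
      using w(1,2)[of y] mult_left_le_one_le[of "s $ y - c" "w y"]
        mult_nonneg_nonpos[of "w y" "s $ y - c"] by (cases "s $ y \<ge> c") auto
  qed
  also have "\<dots> = (\<Sum>k=1..CARD('c). max 0 (kth_greatest s k - c))"
    by (rule sum_kth_greatest[symmetric])
  also have "\<dots> = (\<Sum>k=1..m. kth_greatest s k - c)"
  proof (rule sum.mono_neutral_cong_right)
    show "\<forall>k\<in>{1..CARD('c)} - {1..m}. max 0 (kth_greatest s k - c) = 0"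
      using m kth_greatest_antimono[of m _ s] by (fastforce simp: c_def)
    show "max 0 (kth_greatest s k - c) = kth_greatest s k - c" if "k \<in> {1..m}" for k
      using that m kth_greatest_antimono[of k m s] by (simp add: c_def)
  qed (use m in auto)
  finally show ?thesis
    using w(3) by (simp add: right_diff_distrib sum_subtractf flip: sum_distrib_right)
qed

definition cond_hinge_risk :: "real ^ 'c::finite \<Rightarrow> nat \<Rightarrow> real ^ 'c \<Rightarrow> real" where
  "cond_hinge_risk p K s =
     (\<Sum>y\<in>UNIV. p $ y * (1 / real K * (\<Sum>k=1..K+1. hinge_loss (s $ y - kth_greatest s k))))"

lemma cond_hinge_risk_zero_le:
  fixes p s :: "real ^ 'c::finite"
  assumes p: "\<And>y. 0 \<le> p $ y" "(\<Sum>y\<in>UNIV. p $ y) = 1" and C: "K + 2 \<le> CARD('c)"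
    and tail: "(\<Sum>k=K+2..CARD('c). kth_greatest p k) > real K / (real K + 1)"
  shows "cond_hinge_risk p K 0 \<le> cond_hinge_risk p K s"
proof -
  let ?T = "\<Sum>k=1..K+1. kth_greatest s k"
  \<comment> \<open>Both bounds come from counting: no entry of the zero vector exceeds 0, while all
    of them exceed any negative \<open>a\<close>.\<close>
  have kth0: "kth_greatest (0 :: real ^ 'c) k = 0" if k: "k \<in> {1..K+1}" for k
  proof (rule antisym)
    show "kth_greatest (0 :: real ^ 'c) k \<le> 0"
      using less_kth_greatest_iff[of k 0 "0 :: real ^ 'c"] k C by (simp flip: not_less)
    show "0 \<le> kth_greatest (0 :: real ^ 'c) k"
    proof (rule dense_le)
      fix a :: real assume "a < 0"
      then have "a < kth_greatest (0 :: real ^ 'c) k"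
        using less_kth_greatest_iff[of k a "0 :: real ^ 'c"] k C by simp
      then show "a \<le> kth_greatest (0 :: real ^ 'c) k" by simp
    qed
  qed
  have "cond_hinge_risk p K 0 = (\<Sum>y\<in>UNIV. p $ y * (1 / real K * (real K + 1)))"
    unfolding cond_hinge_risk_def using kth0 by (simp add: hinge_loss_def add.commute)
  also have "\<dots> = 1 / real K * (real K + 1)"
    using p(2) by (simp flip: sum_distrib_right sum_divide_distrib)
  also have "\<dots> \<le> 1 / real K * (real K + 1 + (?T - (\<Sum>y\<in>UNIV. (real K + 1) * p $ y * s $ y)))"
  proof -
    \<comment> \<open>The weights \<open>(K + 1) * p y\<close> are at most 1 by the tail condition;
      this is the only place where it enters.\<close>
    have "(\<Sum>y\<in>UNIV. (real K + 1) * p $ y * s $ y) \<le> ?T"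
    proof (rule weighted_sum_le_sum_kth_greatest)
      show "(\<Sum>y\<in>UNIV. (real K + 1) * p $ y) = real (K + 1)"
        using p(2) by (simp flip: sum_distrib_left)
    qed (use entry_le_if_tail_gt[OF p C tail] p C in auto)
    then show ?thesis by (intro mult_left_mono) auto
  qed
  also have "\<dots> = (\<Sum>y\<in>UNIV. p $ y * (1 / real K * (real K + 1 - (real K + 1) * s $ y + ?T)))"
  proof -
    have "(\<Sum>y\<in>UNIV. p $ y * (1 / real K * (real K + 1 - (real K + 1) * s $ y + ?T)))
       = (\<Sum>y\<in>UNIV. p $ y * (1 / real K * (real K + 1 + ?T))
            - 1 / real K * ((real K + 1) * p $ y * s $ y))"
      by (rule sum.cong[OF refl]) argo
    also have "\<dots> = 1 / real K * (real K + 1 + ?T)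
         - 1 / real K * (\<Sum>y\<in>UNIV. (real K + 1) * p $ y * s $ y)"
      unfolding sum_subtractf sum_distrib_right[symmetric] sum_distrib_left[symmetric] p(2) by simp
    finally show ?thesis by argo
  qed
  also have "\<dots> \<le> cond_hinge_risk p K s"
    unfolding cond_hinge_risk_def
  proof (intro sum_mono mult_left_mono)
    fix y
    have "real K + 1 - (real K + 1) * s $ y + ?T = (\<Sum>k=1..K+1. 1 - (s $ y - kth_greatest s k))"
      by (simp add: sum_subtractf sum.distrib algebra_simps)
    also have "\<dots> \<le> (\<Sum>k=1..K+1. hinge_loss (s $ y - kth_greatest s k))"
      by (intro sum_mono) (simp add: hinge_loss_def)
    finally show "real K + 1 - (real K + 1) * s $ y + ?T
        \<le> (\<Sum>k=1..K+1. hinge_loss (s $ y - kth_greatest s k))" .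
  qed (use p in auto)
  finally show ?thesis .
qed

section \<open>Strict disadvantage of the zero score in conditional \<open>AUTKC\<close>
  risk\<close>

definition cond_autkc_risk :: "real ^ 'c::finite \<Rightarrow> nat \<Rightarrow> real ^ 'c \<Rightarrow> real" where
  "cond_autkc_risk p K s =
     (\<Sum>y\<in>UNIV. p $ y * (1 / real K * (\<Sum>k=1..K. of_bool (position p s y > k))))"

text \<open>Positions form a permutation of the ranks, so the total over all labels is the same for
  every score vector.\<close>

lemma sum_position:
  fixes p s :: "real ^ 'c::finite"
  assumes "no_ties p"
  shows "(\<Sum>y\<in>UNIV. h (position p s y)) = (\<Sum>i=1..CARD('c). h i)"
proof -
  have "sorted_position p s (position p s)"
    unfolding position_def by (rule theI'[OF position_unique(1)[OF assms]])
  then show ?thesis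
    unfolding sorted_position_def by (metis sum.reindex_bij_betw)
qed

text \<open>Chebyshev's sum inequality in strict form. The double sum of
  \<open>(a i - a j) * (b i - b j)\<close> equals twice \<open>card I\<close> times the sum of
  \<open>a i * b i\<close>, minus twice the product of the two totals, and that product vanishes
  because \<open>b\<close> sums to zero.\<close>

lemma sum_comonotone_pos:
  fixes a b :: "'i \<Rightarrow> real"
  assumes "finite I" and co: "\<And>i j. i \<in> I \<Longrightarrow> j \<in> I \<Longrightarrow> 0 \<le> (a i - a j) * (b i - b j)"
    and b: "(\<Sum>i\<in>I. b i) = 0"
    and ij: "u \<in> I" "v \<in> I" "0 < (a u - a v) * (b u - b v)"
  shows "0 < (\<Sum>i\<in>I. a i * b i)"
proof -
  \<comment> \<open>Row \<open>u\<close> of the double sum is positive because of its entry at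
    \<open>v\<close>; the remaining rows are nonnegative.\<close>
  have "0 < (\<Sum>j\<in>I. (a u - a j) * (b u - b j))"
    by (rule sum_pos2[where i = v]) (use assms in auto)
  then have "0 < (\<Sum>i\<in>I. \<Sum>j\<in>I. (a i - a j) * (b i - b j))"
    by (rule sum_pos2[where i = u, rotated 2]) (use assms in \<open>auto intro!: sum_nonneg\<close>)
  also have "\<dots> = (\<Sum>i\<in>I. real (card I) * (a i * b i) - b i * (\<Sum>j\<in>I. a j) + (\<Sum>j\<in>I. a j * b j))"
  proof (rule sum.cong[OF refl])
    fix i
    have "(\<Sum>j\<in>I. (a i - a j) * (b i - b j))
        = (\<Sum>j\<in>I. a i * b i - b i * a j + a j * b j - a i * b j)"
      by (rule sum.cong[OF refl]) (simp add: algebra_simps)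
    also have "\<dots> = real (card I) * (a i * b i) - b i * (\<Sum>j\<in>I. a j) + (\<Sum>j\<in>I. a j * b j)"
      by (simp add: sum.distrib sum_subtractf b flip: sum_distrib_left)
    finally show "(\<Sum>j\<in>I. (a i - a j) * (b i - b j))
        = real (card I) * (a i * b i) - b i * (\<Sum>j\<in>I. a j) + (\<Sum>j\<in>I. a j * b j)" .
  qed
  also have "\<dots> = 2 * real (card I) * (\<Sum>i\<in>I. a i * b i)"
    by (simp add: sum.distrib sum_subtractf b flip: sum_distrib_left sum_distrib_right)
  finally show ?thesis by (simp add: zero_less_mult_iff)
qed

text \<open>Moving from the score \<open>p\<close> to the score 0 raises the loss most for the most
  probable labels. The total change over all labels is zero, so its average weighted by
  \<open>p\<close> is positive.\<close>

lemma cond_autkc_risk_zero_gt: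
  fixes p :: "real ^ 'c::finite"
  assumes nt: "no_ties p" and K: "1 \<le> K" and C: "2 \<le> CARD('c)"
  shows "cond_autkc_risk p K p < cond_autkc_risk p K 0"
proof -
  \<comment> \<open>This is \<open>K\<close> times the loss at position \<open>n\<close>, that is,
    the minimum of \<open>K\<close> and \<open>n - 1\<close>.\<close>
  define g where "g n = (\<Sum>k=1..K. of_bool (n > k) :: real)" for n
  have g_mono: "g m \<le> g n" if "m \<le> n" for m n
    unfolding g_def by (rule sum_mono) (use that in auto)
  have g1: "g (Suc 0) = 0" by (simp add: g_def)
  have g_pos: "0 < g n" if "2 \<le> n" for n
    unfolding g_def by (rule sum_pos2[where i = 1]) (use that K in auto)
  have inj: "inj (($) p)" by (rule no_ties_imp_inj[OF nt])
  \<comment> \<open>For the score \<open>p\<close> the tie clause of the counting formula is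
    contradictory; for the score 0 all labels are tied and only that clause remains.\<close>
  have pos_p: "position p p y = Suc (card {z. p $ y < p $ z})"
    and pos_0: "position p 0 y = Suc (card {z. p $ z < p $ y})" for y
    using inj unfolding position_unique(2)[OF nt] by (auto intro: arg_cong[where f = card])
  define b where "b y = g (position p 0 y) - g (position p p y)" for y
  have b_mono: "b y \<le> b z" if "p $ y \<le> p $ z" for y z
  proof -
    have "position p 0 y \<le> position p 0 z" "position p p z \<le> position p p y"
      unfolding pos_p pos_0 using that by (auto intro!: card_mono)
    then show ?thesis unfolding b_def by (intro diff_mono g_mono)
  qed
  \<comment> \<open>The most probable label \<open>u\<close> moves from the first position to the
    last, the least probable label \<open>v\<close> the other way. With at least two labels this
    makes \<open>b u\<close> positive and \<open>b v\<close> negative.\<close>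
  obtain u where u: "\<And>z. p $ z \<le> p $ u"
    using Max_in[of "range (($) p)"] Max_ge[of "range (($) p)"] by fastforce
  obtain v where v: "\<And>z. p $ v \<le> p $ z"
    using Min_in[of "range (($) p)"] Min_le[of "range (($) p)"] by fastforce
  have "u \<noteq> v"
  proof
    assume "u = v"
    then have "z = u" for z
      using u[of z] v[of z] inj by (auto dest: injD)
    then have "(UNIV :: 'c set) = {u}" by auto
    then have "CARD('c) = card {u}" by (rule arg_cong)
    then show False using C by simp
  qed
  with u[of v] inj have vu: "p $ v < p $ u" by (auto simp: less_le dest: injD)
  have "{z. p $ u < p $ z} = {}" "{z. p $ z < p $ v} = {}"
    using u v by (auto simp: not_less)
  moreover have "0 < card {z. p $ z < p $ u}" "0 < card {z. p $ v < p $ z}"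
    using vu by (auto simp: card_gt_0_iff)
  ultimately have "b v < b u"
    using g_pos[of "position p 0 u"] g_pos[of "position p p v"] g1
    by (simp add: b_def pos_p pos_0)
  have "0 < (\<Sum>y\<in>UNIV. p $ y * b y)"
  proof (rule sum_comonotone_pos[where u = u and v = v])
    show "0 \<le> (p $ y - p $ z) * (b y - b z)" for y z
      using b_mono[of y z] b_mono[of z y] by (cases "p $ y \<le> p $ z") (auto simp: zero_le_mult_iff)
    show "(\<Sum>y\<in>UNIV. b y) = 0"
      unfolding b_def sum_subtractf sum_position[OF nt] by simp
  qed (use vu \<open>b v < b u\<close> in auto)
  also have "\<dots> = real K * (cond_autkc_risk p K 0 - cond_autkc_risk p K p)"
    unfolding cond_autkc_risk_def b_def g_def sum_subtractf[symmetric] sum_distrib_left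
    using K by (intro sum.cong) (auto simp: field_simps)
  finally show ?thesis using K by (simp add: zero_less_mult_iff)
qed

section \<open>From pointwise comparisons to a minimizing sequence with excess risk\<close>

theorem theorem5:
  fixes X :: "'x measure"
    and D :: "('x \<times> 'c::finite) measure"
    and \<eta> :: "'x \<Rightarrow> real ^ 'c"
    and K :: nat
  assumes "prob_space D"
    and "sets D = sets (X \<Otimes>\<^sub>M count_space UNIV)"
    and "label_posterior X D \<eta>"
    and "\<And>x. x \<in> space X \<Longrightarrow> no_ties (\<eta> x)"
    and "K \<ge> 1"
    and "measure (distr D X fst)
           {x \<in> space X. (\<Sum>k=K+2..CARD('c). kth_greatest (\<eta> x) k) > real K / (real K + 1)} > 0"
  shows "\<not> autkc_consistent X D \<eta> K hinge_loss"
proof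
  assume cons: "autkc_consistent X D \<eta> K hinge_loss"
  note sD = assms(2) and post = assms(3) and nt = assms(4) and K = assms(5)
  define \<mu> where "\<mu> = distr D X fst"
  define G where "G = {x \<in> space X. (\<Sum>k=K+2..CARD('c). kth_greatest (\<eta> x) k) > real K / (real K + 1)}"
  interpret D: prob_space D by fact
  have [measurable_cong]: "sets \<mu> = sets X" and sp\<mu>: "space \<mu> = space X"
    by (simp_all add: \<mu>_def)
  have posG: "0 < measure \<mu> G" using assms(6) by (simp add: \<mu>_def G_def)
  \<comment> \<open>A set outside the sigma-algebra has \<open>measure\<close> 0 by convention, so
    positive measure forces measurability.\<close>
  have G[measurable]: "G \<in> sets X"
  proof (rule ccontr)
    assume "G \<notin> sets X"
    then have "G \<notin> sets \<mu>" by (simp add: \<mu>_def)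
    then show False using posG measure_notin_sets by fastforce
  qed
  have \<eta>[measurable]: "\<eta> \<in> borel_measurable X"
    and \<eta>0: "\<And>x y. x \<in> space X \<Longrightarrow> 0 \<le> \<eta> x $ y"
    and \<eta>1: "\<And>x. x \<in> space X \<Longrightarrow> (\<Sum>y\<in>UNIV. \<eta> x $ y) = 1"
    using post by (auto simp: label_posterior_def)
  \<comment> \<open>With fewer than \<open>K + 2\<close> labels the tail is an empty sum and cannot
    exceed \<open>K / (K + 1)\<close>.\<close>
  have C: "K + 2 \<le> CARD('c)"
  proof (rule ccontr)
    assume "\<not> K + 2 \<le> CARD('c)"
    then have "G = {}" by (auto simp: G_def not_less)
    then show False using posG by simp
  qed
  have [measurable]: "(\<lambda>x. kth_greatest (f x) k) \<in> borel_measurable X"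
    if "f \<in> borel_measurable X" "k \<in> {1..K+1}" for f :: "'x \<Rightarrow> real ^ 'c" and k
    using that C by (intro kth_greatest_measurable) auto
  have [measurable]: "(\<lambda>x. position (\<eta> x) (f x) y) \<in> measurable X (count_space UNIV)"
    if "f \<in> borel_measurable X" for f y
    using that nt by (intro position_measurable) auto
  have surr: "surrogate_risk D K hinge_loss f = (\<integral>\<^sup>+x. ennreal (cond_hinge_risk (\<eta> x) K (f x)) \<partial>\<mu>)"
    if f[measurable]: "f \<in> borel_measurable X" for f
    unfolding surrogate_risk_def cond_hinge_risk_def \<mu>_def
  proof (rule label_posterior_nn_integral[OF sD post])
    show "(\<lambda>x. 1 / real K * (\<Sum>k=1..K+1. hinge_loss (f x $ y - kth_greatest (f x) k)))
        \<in> borel_measurable X" for y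
      unfolding hinge_loss_def by measurable
  qed (intro mult_nonneg_nonneg sum_nonneg, auto simp: hinge_loss_def)
  have autkc: "autkc_risk D \<eta> K f = (\<integral>\<^sup>+x. ennreal (cond_autkc_risk (\<eta> x) K (f x)) \<partial>\<mu>)"
    if f[measurable]: "f \<in> borel_measurable X" for f
    unfolding autkc_risk_def cond_autkc_risk_def \<mu>_def
  proof (rule label_posterior_nn_integral[OF sD post])
    show "(\<lambda>x. 1 / real K * (\<Sum>k=1..K. of_bool (position (\<eta> x) (f x) y > k)))
        \<in> borel_measurable X" for y
      unfolding of_bool_def by measurable
  qed (intro mult_nonneg_nonneg sum_nonneg, auto)
  have autkc_meas[measurable]: "(\<lambda>x. cond_autkc_risk (\<eta> x) K (f x)) \<in> borel_measurable X"
    if f[measurable]: "f \<in> borel_measurable X" for f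
    unfolding cond_autkc_risk_def of_bool_def by measurable
  let ?S = "surrogate_risk D K hinge_loss" and ?A = "autkc_risk D \<eta> K"
  let ?F = "score_functions X :: ('x \<Rightarrow> real ^ 'c) set"
  have ne: "?S ` ?F \<noteq> {}" using \<eta> by blast
  \<comment> \<open>The infimum need not be attained, so a sequence of risk values decreasing to it
    is chosen and then lifted to score functions \<open>g t\<close>.\<close>
  obtain r :: "nat \<Rightarrow> ennreal" where r: "decseq r" "range r \<subseteq> ?S ` ?F" "Inf (?S ` ?F) = (INF i. r i)"
    using ennreal_Inf_countable_INF[OF ne] by auto
  then have "\<forall>t. \<exists>g\<in>?F. r t = ?S g" by auto
  then obtain g where g[measurable]: "\<And>t. g t \<in> ?F" and rg: "\<And>t. r t = ?S (g t)" by metis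
  have glim: "(\<lambda>t. ?S (g t)) \<longlonglongrightarrow> (INF g\<in>?F. ?S g)"
    using LIMSEQ_INF[OF r(1)] unfolding r(3) rg .
  define f where "f t x = (if x \<in> G then 0 else g t x)" for t x
  \<comment> \<open>\<open>h t\<close> is the competitor of \<open>f t\<close>: they agree off
    \<open>G\<close>, and on \<open>G\<close> neither depends on \<open>t\<close>, so their
    \<open>AUTKC\<close> risks differ by a constant.\<close>
  define h where "h t x = (if x \<in> G then \<eta> x else g t x)" for t x
  have f[measurable]: "f t \<in> ?F" and h[measurable]: "h t \<in> ?F" for t
    unfolding f_def h_def by measurable
  have "?S (f t) \<le> ?S (g t)" for t
    unfolding surr[OF f] surr[OF g]
  proof (rule nn_integral_mono, rule ennreal_leI)
    fix x assume "x \<in> space \<mu>"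
    then show "cond_hinge_risk (\<eta> x) K (f t x) \<le> cond_hinge_risk (\<eta> x) K (g t x)"
      using cond_hinge_risk_zero_le[OF \<eta>0 \<eta>1 C] by (simp add: f_def G_def sp\<mu>)
  qed
  then have "(\<lambda>t. ?S (f t)) \<longlonglongrightarrow> (INF g\<in>?F. ?S g)"
    by (intro tendsto_sandwich[OF _ _ tendsto_const glim] always_eventually allI INF_lower f)
  with cons f have lim: "(\<lambda>t. ?A (f t)) \<longlonglongrightarrow> (INF g\<in>?F. ?A g)"
    unfolding autkc_consistent_def by blast
  define \<delta> where "\<delta> x = (if x \<in> G then cond_autkc_risk (\<eta> x) K 0 - cond_autkc_risk (\<eta> x) K (\<eta> x) else 0)" for x
  have \<delta>_pos: "0 < \<delta> x" if "x \<in> G" for x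
    using that nt K C cond_autkc_risk_zero_gt[of "\<eta> x" K] by (simp add: \<delta>_def G_def)
  have \<delta>[measurable]: "\<delta> \<in> borel_measurable X"
    unfolding \<delta>_def by measurable
  define c where "c = (\<integral>\<^sup>+x. ennreal (\<delta> x) \<partial>\<mu>)"
  have "c \<noteq> 0"
  proof
    assume "c = 0"
    then have "AE x in \<mu>. ennreal (\<delta> x) = 0"
      unfolding c_def by (subst (asm) nn_integral_0_iff_AE) auto
    then have "AE x in \<mu>. x \<notin> G"
      by eventually_elim (use \<delta>_pos in \<open>force simp: ennreal_eq_0_iff\<close>)
    then have "emeasure \<mu> G = 0"
      by (subst (asm) AE_iff_measurable[OF _ refl]) (use G sets.sets_into_space[OF G] in \<open>auto simp: sp\<mu> Int_absorb1 Collect_conj_eq\<close>)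
    then show False using posG by (simp add: measure_def)
  qed
  have cond_nn: "0 \<le> cond_autkc_risk (\<eta> x) K s" if "x \<in> space X" for x s
    unfolding cond_autkc_risk_def using \<eta>0[OF that] by (auto intro!: sum_nonneg mult_nonneg_nonneg)
  \<comment> \<open>The gap is stated additively because subtraction in \<open>ennreal\<close>
    truncates.\<close>
  have "?A (f t) = ?A (h t) + c" for t
  proof -
    have "?A (f t) = (\<integral>\<^sup>+x. ennreal (cond_autkc_risk (\<eta> x) K (h t x)) + ennreal (\<delta> x) \<partial>\<mu>)"
      unfolding autkc[OF f]
    proof (rule nn_integral_cong)
      fix x assume "x \<in> space \<mu>"
      then have "ennreal (cond_autkc_risk (\<eta> x) K (h t x)) + ennreal (\<delta> x)
          = ennreal (cond_autkc_risk (\<eta> x) K (h t x) + \<delta> x)"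
        using cond_nn \<delta>_pos[of x] by (cases "x \<in> G") (auto simp: sp\<mu> \<delta>_def)
      then show "ennreal (cond_autkc_risk (\<eta> x) K (f t x))
          = ennreal (cond_autkc_risk (\<eta> x) K (h t x)) + ennreal (\<delta> x)"
        by (simp add: \<delta>_def f_def h_def)
    qed
    also have "\<dots> = ?A (h t) + c"
      unfolding autkc[OF h] c_def by (rule nn_integral_add) measurable
    finally show ?thesis .
  qed
  then have "(INF g\<in>?F. ?A g) + c \<le> ?A (f t)" for t
    using h by (simp add: INF_lower add_right_mono)
  then have le: "(INF g\<in>?F. ?A g) + c \<le> (INF g\<in>?F. ?A g)"
    using LIMSEQ_le_const[OF lim] by blast
  \<comment> \<open>The loss is at most 1, so the infimum is finite; only then can it be cancelled
    in \<open>le\<close> to contradict \<open>c \<noteq> 0\<close>.\<close>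
  have "?A \<eta> \<le> (\<integral>\<^sup>+w. 1 \<partial>D)"
    unfolding autkc_risk_def
  proof (rule nn_integral_mono)
    fix w :: "'x \<times> 'c"
    have "1 / real K * (\<Sum>k=1..K. of_bool (position (\<eta> x) (\<eta> x) y > k)) \<le> 1" for x y
    proof -
      have "(\<Sum>k=1..K. of_bool (position (\<eta> x) (\<eta> x) y > k) :: real) \<le> (\<Sum>k=1..K. 1)"
        by (rule sum_mono) simp
      then show ?thesis using K by (simp add: field_simps)
    qed
    then show "(case w of (x, y) \<Rightarrow> ennreal (1 / real K * (\<Sum>k=1..K. of_bool (position (\<eta> x) (\<eta> x) y > k)))) \<le> 1"
      by (simp add: case_prod_beta ennreal_le_1)
  qed
  also have "\<dots> = 1" by (simp add: D.emeasure_space_1)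
  finally have "(INF g\<in>?F. ?A g) \<le> 1"
    using INF_lower[OF \<eta>, of ?A] by (rule order_trans[rotated])
  then have "(INF g\<in>?F. ?A g) \<noteq> \<top>"
    using ennreal_one_neq_top top_unique by metis
  with le \<open>c \<noteq> 0\<close> show False
    by (metis ennreal_add_left_cancel_le add.right_neutral le_zero_eq infinity_ennreal_def)
qed

end
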